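(* Let $\kappa$ be a regular uncountable cardinal and let $\mathcal T=(T_\alpha)_{\alpha<\kappa}$ be a tower. Then there is a ccc forcing notion $\mathbb P$ which generically adds a tower $\mathcal T'=(T'_\alpha)_{\alpha<\kappa}$ such that $|T_\alpha\setminus T'_\alpha|\le 1$ and $|T'_\alpha\setminus T_\alpha|\le 1$ for each $\alpha<\kappa$, and $\mathbb P$ forces that $\mathcal T'$ satisfies condition (K), i.e. that $T'_\alpha\nsubseteq T'_\beta$ for all distinct $\alpha,\beta<\kappa$.
   Context: A tower of length $\kappa$ is a family $(T_\alpha)_{\alpha<\kappa}$ of subsets of $\omega$ such that, for all $\alpha,\beta<\kappa$, $T_\alpha\setminus T_\beta$ is finite if and only if $\alpha\le\beta$ (no maximality is assumed).
   Formalization: All sets T_α of the tower are assumed infinite; this is automatic for α > 0, so it only requires T_0 to be infinite, and without it the claim fails, e.g. for T_0 empty and T_k = {n : 2^k does not divide n+1} (1 ≤ k < ω) continued to length ω_1. *)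

theory Defs
  imports "HOL-Library.Countable_Set"
begin

unbundle cardinal_syntax

text \<open>A cardinal is a well-order \<open>\<kappa>\<close> with \<open>Card_order \<kappa>\<close>; the ordinals below it are the
  elements of \<open>Field \<kappa>\<close>, and \<open>(\<alpha>, \<beta>) \<in> \<kappa>\<close> means \<open>\<alpha> \<le> \<beta>\<close>.\<close>

definition tower :: "'k rel \<Rightarrow> ('k \<Rightarrow> nat set) \<Rightarrow> bool" where
  "tower \<kappa> T \<longleftrightarrow>
     (\<forall>\<alpha>\<in>Field \<kappa>. \<forall>\<beta>\<in>Field \<kappa>. finite (T \<alpha> - T \<beta>) \<longleftrightarrow> (\<alpha>, \<beta>) \<in> \<kappa>)"

text \<open>Only the first set of a tower can be finite. It has to be required to be infinite below: if
  \<open>T\<^sub>0 = {}\<close> and \<open>T\<^sub>k = {n. \<not> 2 ^ k dvd n + 1}\<close> for \<open>1 \<le> k < \<omega>\<close>, then no \<open>T'\<close> in any extension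
  differs from \<open>T\<close> by at most one point in each direction and satisfies \<open>\<not> T'\<^sub>\<alpha> \<subseteq> T'\<^sub>\<beta>\<close>
  for all \<open>\<alpha> \<noteq> \<beta>\<close>.\<close>

text \<open>A name \<open>\<tau>\<close> of type \<open>('a, 'p) nm\<close> denotes, in the extension by a generic filter \<open>G\<close>, the set
  \<open>{a. \<exists>r\<in>G. (a, r) \<in> \<tau>}\<close>; that is, \<open>\<tau>\<close> is a name all of whose elements are pairs of a check name
  and a condition. Every subset, in the extension, of a ground model set has such a name.\<close>

type_synonym ('a, 'p) nm = "('a \<times> 'p) set"

text \<open>A sentence of the forcing language is represented by the set (as a predicate) of the
  conditions forcing it. The connectives below are the clauses of the usual recursive definition
  of the forcing relation for the primitives \<open>\<in>\<close>, \<open>\<not>\<close>, \<open>\<and>\<close>, \<open>\<forall>\<close>; the other connectives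
  are the usual abbreviations.\<close>

type_synonym 'p sentence = "'p \<Rightarrow> bool"

locale forcing =
  fixes R :: "'p rel"  \<comment> \<open>\<open>(q, p) \<in> R\<close>: the condition \<open>q\<close> is stronger than \<open>p\<close>\<close>
  assumes preorder: "preorder_on (Field R) R"
    and nonempty: "Field R \<noteq> {}"
begin

definition compatible :: "'p \<Rightarrow> 'p \<Rightarrow> bool" where
  "compatible p q \<longleftrightarrow> (\<exists>r. (r, p) \<in> R \<and> (r, q) \<in> R)"

definition ccc :: bool where
  "ccc \<longleftrightarrow> (\<forall>A \<subseteq> Field R. (\<forall>p\<in>A. \<forall>q\<in>A. p \<noteq> q \<longrightarrow> \<not> compatible p q) \<longrightarrow> countable A)"

definition names :: "'a set \<Rightarrow> ('a, 'p) nm set" where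
  "names A = Pow (A \<times> Field R)"

definition check :: "'a set \<Rightarrow> ('a, 'p) nm" where
  "check A = A \<times> Field R"

definition Mem :: "'a \<Rightarrow> ('a, 'p) nm \<Rightarrow> 'p sentence"  (infix \<open>\<^bold>\<in>\<close> 50) where
  "(a \<^bold>\<in> \<tau>) = (\<lambda>p. \<forall>q. (q, p) \<in> R \<longrightarrow> (\<exists>q'. (q', q) \<in> R \<and> (\<exists>r. (a, r) \<in> \<tau> \<and> (q', r) \<in> R)))"

text \<open>Absolute sentences about ground model objects:\<close>

definition Ground :: "bool \<Rightarrow> 'p sentence" where
  "Ground b = (\<lambda>p. b)"

definition Neg :: "'p sentence \<Rightarrow> 'p sentence"  (\<open>\<^bold>\<not> _\<close> [40] 40) where
  "(\<^bold>\<not> \<phi>) = (\<lambda>p. \<forall>q. (q, p) \<in> R \<longrightarrow> \<not> \<phi> q)"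

definition Conj :: "'p sentence \<Rightarrow> 'p sentence \<Rightarrow> 'p sentence"  (infixr \<open>\<^bold>\<and>\<close> 35) where
  "(\<phi> \<^bold>\<and> \<psi>) = (\<lambda>p. \<phi> p \<and> \<psi> p)"

text \<open>Quantification over the elements of a ground model set:\<close>

definition Forall :: "'a set \<Rightarrow> ('a \<Rightarrow> 'p sentence) \<Rightarrow> 'p sentence" where
  "Forall A \<phi> = (\<lambda>p. \<forall>a\<in>A. \<phi> a p)"

text \<open>Quantification over all subsets, in the extension, of a ground model set:\<close>

definition Forall_subset :: "'a set \<Rightarrow> (('a, 'p) nm \<Rightarrow> 'p sentence) \<Rightarrow> 'p sentence" where
  "Forall_subset A \<phi> = (\<lambda>p. \<forall>\<tau>\<in>names A. \<phi> \<tau> p)"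

definition Imp :: "'p sentence \<Rightarrow> 'p sentence \<Rightarrow> 'p sentence"  (infixr \<open>\<^bold>\<longrightarrow>\<close> 25) where
  "(\<phi> \<^bold>\<longrightarrow> \<psi>) = (\<^bold>\<not> (\<phi> \<^bold>\<and> (\<^bold>\<not> \<psi>)))"

definition Iff :: "'p sentence \<Rightarrow> 'p sentence \<Rightarrow> 'p sentence"  (infixr \<open>\<^bold>\<longleftrightarrow>\<close> 25) where
  "(\<phi> \<^bold>\<longleftrightarrow> \<psi>) = ((\<phi> \<^bold>\<longrightarrow> \<psi>) \<^bold>\<and> (\<psi> \<^bold>\<longrightarrow> \<phi>))"

definition Exists :: "'a set \<Rightarrow> ('a \<Rightarrow> 'p sentence) \<Rightarrow> 'p sentence" where
  "Exists A \<phi> = (\<^bold>\<not> Forall A (\<lambda>a. \<^bold>\<not> \<phi> a))"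

definition Exists_subset :: "'a set \<Rightarrow> (('a, 'p) nm \<Rightarrow> 'p sentence) \<Rightarrow> 'p sentence" where
  "Exists_subset A \<phi> = (\<^bold>\<not> Forall_subset A (\<lambda>\<tau>. \<^bold>\<not> \<phi> \<tau>))"

definition forced :: "'p sentence \<Rightarrow> bool" where
  "forced \<phi> \<longleftrightarrow> (\<forall>p\<in>Field R. \<phi> p)"

text \<open>Subsets of \<open>\<omega>\<close> in the extension are given below by their defining formula \<open>\<phi>\<close>. The set
  \<open>{n. \<phi> n}\<close> is finite if some \<open>F \<subseteq> \<omega> \<times> \<omega>\<close> in the extension is a bijection from it onto
  some \<open>m = {..<m}\<close>.\<close>

definition Bijection :: "(nat \<times> nat, 'p) nm \<Rightarrow> (nat \<Rightarrow> 'p sentence) \<Rightarrow> nat \<Rightarrow> 'p sentence" where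
  "Bijection F \<phi> m =
     (Forall UNIV (\<lambda>i. Forall UNIV (\<lambda>j. (i, j) \<^bold>\<in> F \<^bold>\<longrightarrow> \<phi> i \<^bold>\<and> Ground (j < m)))
      \<^bold>\<and> Forall UNIV (\<lambda>i. \<phi> i \<^bold>\<longrightarrow> Exists UNIV (\<lambda>j. (i, j) \<^bold>\<in> F))
      \<^bold>\<and> Forall {..<m} (\<lambda>j. Exists UNIV (\<lambda>i. (i, j) \<^bold>\<in> F))
      \<^bold>\<and> Forall UNIV (\<lambda>i. Forall UNIV (\<lambda>j. Forall UNIV (\<lambda>j'.
           (i, j) \<^bold>\<in> F \<^bold>\<and> (i, j') \<^bold>\<in> F \<^bold>\<longrightarrow> Ground (j = j'))))
      \<^bold>\<and> Forall UNIV (\<lambda>i. Forall UNIV (\<lambda>i'. Forall UNIV (\<lambda>j.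
           (i, j) \<^bold>\<in> F \<^bold>\<and> (i', j) \<^bold>\<in> F \<^bold>\<longrightarrow> Ground (i = i')))))"

definition Finite :: "(nat \<Rightarrow> 'p sentence) \<Rightarrow> 'p sentence" where
  "Finite \<phi> = Exists UNIV (\<lambda>m. Exists_subset UNIV (\<lambda>F. Bijection F \<phi> m))"

definition At_most_one :: "(nat \<Rightarrow> 'p sentence) \<Rightarrow> 'p sentence" where
  "At_most_one \<phi> = Forall UNIV (\<lambda>i. Forall UNIV (\<lambda>j. \<phi> i \<^bold>\<and> \<phi> j \<^bold>\<longrightarrow> Ground (i = j)))"

definition In_diff :: "(nat, 'p) nm \<Rightarrow> (nat, 'p) nm \<Rightarrow> nat \<Rightarrow> 'p sentence" where
  "In_diff \<sigma> \<tau> n = (n \<^bold>\<in> \<sigma> \<^bold>\<and> (\<^bold>\<not> n \<^bold>\<in> \<tau>))"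

definition Subset :: "(nat, 'p) nm \<Rightarrow> (nat, 'p) nm \<Rightarrow> 'p sentence" where
  "Subset \<sigma> \<tau> = Forall UNIV (\<lambda>n. n \<^bold>\<in> \<sigma> \<^bold>\<longrightarrow> n \<^bold>\<in> \<tau>)"

definition Tower :: "'k rel \<Rightarrow> ('k \<Rightarrow> (nat, 'p) nm) \<Rightarrow> 'p sentence" where
  "Tower \<kappa> T' = Forall (Field \<kappa>) (\<lambda>\<alpha>. Forall (Field \<kappa>) (\<lambda>\<beta>.
     Finite (In_diff (T' \<alpha>) (T' \<beta>)) \<^bold>\<longleftrightarrow> Ground ((\<alpha>, \<beta>) \<in> \<kappa>)))"

definition Close :: "'k rel \<Rightarrow> ('k \<Rightarrow> nat set) \<Rightarrow> ('k \<Rightarrow> (nat, 'p) nm) \<Rightarrow> 'p sentence" where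
  "Close \<kappa> T T' = Forall (Field \<kappa>) (\<lambda>\<alpha>.
     At_most_one (In_diff (check (T \<alpha>)) (T' \<alpha>)) \<^bold>\<and> At_most_one (In_diff (T' \<alpha>) (check (T \<alpha>))))"

definition Cond_K :: "'k rel \<Rightarrow> ('k \<Rightarrow> (nat, 'p) nm) \<Rightarrow> 'p sentence" where
  "Cond_K \<kappa> T' = Forall (Field \<kappa>) (\<lambda>\<alpha>. Forall (Field \<kappa>) (\<lambda>\<beta>.
     Ground (\<alpha> \<noteq> \<beta>) \<^bold>\<longrightarrow> (\<^bold>\<not> Subset (T' \<alpha>) (T' \<beta>))))"

end

end

theory Submission
  imports Defs
begin

text \<open>A condition assigns to each of finitely many indices \<open>\<alpha>\<close> a point of \<open>T\<^sub>\<alpha>\<close> to be removed and a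
  point outside \<open>T\<^sub>\<alpha>\<close> to be added, in such a way that the resulting sets \<open>T'\<^sub>\<alpha>\<close> form an antichain
  for \<open>\<subseteq>\<close>. Closeness of \<open>T'\<close> to \<open>T\<close> and condition (K) are then immediate once every index occurs in
  the generic filter, and \<open>T'\<close> is a tower because it is a finite modification of \<open>T\<close> and finiteness
  of a set already decided is absolute (\<open>Finite_decided_iff\<close>).

  Every index can be added to a condition (\<open>conds_dense\<close>): finitely many members of the tower have
  infinitely many common points, from which the point to be removed is taken, and their union
  misses infinitely many points, from which the point to be added is taken.

  For the countable chain condition (\<open>compatible_in_uncountable\<close>), thin an uncountable set of
  conditions so that all have domains of the same size \<open>n\<close>, the same two points at the \<open>i\<close>-th index
  for each \<open>i < n\<close>, and for \<open>i \<noteq> j\<close> a common witness that the \<open>i\<close>-th set is not contained in the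
  \<open>j\<close>-th. These witnesses also work across two conditions, so two conditions that have no index at
  different coordinates can only conflict at equal coordinates. Thin further so that each
  coordinate function is constant, which causes no conflict,
  or has countable fibres and values of order type \<open>\<omega>\<^sub>1\<close>. In the second case, given uncountable sets \<open>I\<close>, \<open>J\<close> of
  conditions, there is a \<open>k\<close> that lies in the \<open>i\<close>-th set for uncountably many members of \<open>I\<close> and
  outside it for uncountably many members of \<open>J\<close> (\<open>uncountable_split\<close>). Otherwise all \<open>i\<close>-th sets
  from uncountably many members of \<open>I\<close> would be contained in all those from uncountably many members
  of \<open>J\<close>, although some of the former lie higher in the tower than some of the latter. As \<open>I\<close> and
  \<open>J\<close> shrink to uncountable sets, this can be repeated for all coordinates and both directions.
  Then any condition in \<open>I\<close> is compatible with all but countably many in \<open>J\<close>: it suffices that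
  none of its indices reappears at a non-constant coordinate.\<close>

section \<open>Evaluating sentences of the forcing language\<close>

context forcing
begin

lemma refl_R: "p \<in> Field R \<Longrightarrow> (p, p) \<in> R"
  using preorder by (simp add: preorder_on_def refl_on_def)

lemma trans_R: "(r, q) \<in> R \<Longrightarrow> (q, p) \<in> R \<Longrightarrow> (r, p) \<in> R"
  using preorder unfolding preorder_on_def by (meson transD)

lemma Imp_iff:
  "(\<phi> \<^bold>\<longrightarrow> \<psi>) p \<longleftrightarrow> (\<forall>q. (q, p) \<in> R \<and> \<phi> q \<longrightarrow> (\<exists>r. (r, q) \<in> R \<and> \<psi> r))"
  by (auto simp: Imp_def Neg_def Conj_def)

lemma ImpD:
  assumes "(\<phi> \<^bold>\<longrightarrow> \<psi>) p" "(q, p) \<in> R" "\<phi> q"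
  obtains r where "(r, q) \<in> R" "\<psi> r"
  using assms unfolding Imp_iff by blast

lemma Exists_iff:
  "Exists A \<phi> p \<longleftrightarrow> (\<forall>q. (q, p) \<in> R \<longrightarrow> (\<exists>a\<in>A. \<exists>r. (r, q) \<in> R \<and> \<phi> a r))"
  by (auto simp: Exists_def Neg_def Forall_def)

lemma Exists_subset_eq: "Exists_subset A \<phi> = Exists (names A) \<phi>"
  by (simp add: Exists_subset_def Exists_def Forall_subset_def Forall_def)

lemma ExistsI:
  assumes "a \<in> A" "\<And>q. (q, p) \<in> R \<Longrightarrow> \<phi> a q"
  shows "Exists A \<phi> p"
  using assms refl_R unfolding Exists_iff by (meson FieldI1)

lemma ExistsE:
  assumes "Exists A \<phi> p" "p \<in> Field R"
  obtains a q where "a \<in> A" "(q, p) \<in> R" "\<phi> a q"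
  using assms refl_R unfolding Exists_iff by blast

lemma Mem_mono: "(a \<^bold>\<in> \<tau>) p \<Longrightarrow> (q, p) \<in> R \<Longrightarrow> (a \<^bold>\<in> \<tau>) q"
  unfolding Mem_def using trans_R by blast

lemma Neg_mono:
  assumes "(\<^bold>\<not> \<phi>) p" "(q, p) \<in> R"
  shows "(\<^bold>\<not> \<phi>) q"
  unfolding Neg_def
proof (intro allI impI)
  fix r
  assume "(r, q) \<in> R"
  then have "(r, p) \<in> R"
    using assms(2) by (rule trans_R)
  then show "\<not> \<phi> r"
    using assms(1) by (simp add: Neg_def)
qed

lemma NegD: "(\<^bold>\<not> \<phi>) p \<Longrightarrow> p \<in> Field R \<Longrightarrow> \<not> \<phi> p"
  by (simp add: Neg_def refl_R)

lemma Finite_mono: "Finite \<phi> p \<Longrightarrow> (q, p) \<in> R \<Longrightarrow> Finite \<phi> q"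
  unfolding Finite_def Exists_def by (rule Neg_mono)

lemma Mem_check_iff:
  assumes "p \<in> Field R"
  shows "(a \<^bold>\<in> check A) p \<longleftrightarrow> a \<in> A"
  unfolding Mem_def check_def using assms refl_R trans_R by (meson FieldI1 mem_Sigma_iff)

text \<open>Finiteness is absolute: below a condition that has decided membership in \<open>\<phi>\<close>, a name of a
  bijection with \<open>m\<close> would, after finitely many values have been decided, violate the pigeonhole
  principle in the ground model if \<open>V\<close> were infinite.\<close>

lemma Finite_decided_iff:
  assumes p: "p \<in> Field R" and dec: "\<And>q i. (q, p) \<in> R \<Longrightarrow> \<phi> i q \<longleftrightarrow> i \<in> V"
  shows "Finite \<phi> p \<longleftrightarrow> finite V"
proof
  assume "Finite \<phi> p"
  then obtain m q where q: "(q, p) \<in> R" "Exists_subset UNIV (\<lambda>F. Bijection F \<phi> m) q"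
    unfolding Finite_def using p by (meson ExistsE)
  then obtain F u where u: "(u, q) \<in> R" and bij: "Bijection F \<phi> m u"
    unfolding Exists_subset_eq by (meson ExistsE FieldI1)
  have up: "(u, p) \<in> R"
    using u q trans_R by blast
  note conjuncts = bij[unfolded Bijection_def Conj_def Forall_def]
  have into: "((i, j) \<^bold>\<in> F \<^bold>\<longrightarrow> (\<lambda>p. \<phi> i p \<and> Ground (j < m) p)) u" for i j
    using conjuncts by blast
  have total: "(\<phi> i \<^bold>\<longrightarrow> Exists UNIV (\<lambda>j. (i, j) \<^bold>\<in> F)) u" for i
    using conjuncts by blast
  have inj: "((\<lambda>p. ((i, j) \<^bold>\<in> F) p \<and> ((i', j) \<^bold>\<in> F) p) \<^bold>\<longrightarrow> Ground (i = i')) u" for i i' j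
    using conjuncts by blast
  have decide: "\<exists>v. (v, u) \<in> R \<and> (\<forall>i\<in>W. \<exists>j<m. ((i, j) \<^bold>\<in> F) v)" if "finite W" "W \<subseteq> V" for W
    using that
  proof (induction W rule: finite_induct)
    case empty
    then show ?case
      using up refl_R FieldI1 by fastforce
  next
    case (insert i W)
    then obtain v where v: "(v, u) \<in> R" "\<forall>i\<in>W. \<exists>j<m. ((i, j) \<^bold>\<in> F) v"
      by auto
    have "\<phi> i v"
      using dec[of v i] v(1) up trans_R insert.prems by blast
    then obtain r where r: "(r, v) \<in> R" "Exists UNIV (\<lambda>j. (i, j) \<^bold>\<in> F) r"
      using ImpD[OF total v(1)] by blast
    then obtain j s where s: "(s, r) \<in> R" "((i, j) \<^bold>\<in> F) s"
      by (meson ExistsE FieldI1)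
    have sv: "(s, v) \<in> R"
      using s(1) r(1) by (rule trans_R)
    then have su: "(s, u) \<in> R"
      using v(1) by (rule trans_R)
    then have "j < m"
      using ImpD[OF into su s(2)] by (auto simp: Ground_def)
    moreover have "\<exists>j<m. ((i', j) \<^bold>\<in> F) s" if "i' \<in> W" for i'
      using v(2) Mem_mono[OF _ sv] that by fast
    ultimately have "\<forall>i'\<in>insert i W. \<exists>j<m. ((i', j) \<^bold>\<in> F) s"
      using s(2) by blast
    then show ?case
      using su by blast
  qed
  show "finite V"
  proof (rule ccontr)
    assume "infinite V"
    then obtain W where W: "W \<subseteq> V" "finite W" "card W = Suc m"
      using infinite_arbitrarily_large by blast
    then obtain v where v: "(v, u) \<in> R" "\<forall>i\<in>W. \<exists>j<m. ((i, j) \<^bold>\<in> F) v"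
      using decide by blast
    then obtain f where f: "\<forall>i\<in>W. f i < m \<and> ((i, f i) \<^bold>\<in> F) v"
      by metis
    then have "f ` W \<subseteq> {..<m}"
      by auto
    then have "card (f ` W) \<le> m"
      by (metis card_lessThan card_mono finite_lessThan)
    then have "\<not> inj_on f W"
      using W(3) card_image by fastforce
    then obtain i i' where i: "i \<in> W" "i' \<in> W" "i \<noteq> i'" "f i = f i'"
      by (auto simp: inj_on_def)
    then have "((i, f i) \<^bold>\<in> F) v \<and> ((i', f i) \<^bold>\<in> F) v"
      using f by metis
    then show False
      using ImpD[OF inj v(1)] i(3) by (auto simp: Ground_def)
  qed
next
  assume "finite V"
  then obtain f where f: "bij_betw f V {..<card V}"
    using ex_bij_betw_finite_nat by (metis atLeast0LessThan)
  define F where "F = check ((\<lambda>i. (i, f i)) ` V)"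
  have F: "F \<in> names UNIV"
    by (auto simp: F_def names_def check_def)
  have Mem_F: "((i, j) \<^bold>\<in> F) q \<longleftrightarrow> i \<in> V \<and> j = f i" if "q \<in> Field R" for i j q
    using that by (auto simp: F_def Mem_check_iff)
  have "Bijection F \<phi> (card V) q" if q: "(q, p) \<in> R" for q
  proof -
    have fld: "r \<in> Field R" "(r, r) \<in> R" "(r, p) \<in> R" if "(r, q) \<in> R" for r
      using that trans_R[OF that q] refl_R[OF FieldI1[OF that]] by (auto intro: FieldI1)
    have q': "(q, q) \<in> R"
      using q refl_R by (meson FieldI1)
    have imp: "(\<alpha> \<^bold>\<longrightarrow> \<beta>) q" if "\<And>r. (r, q) \<in> R \<Longrightarrow> \<alpha> r \<Longrightarrow> \<beta> r" for \<alpha> \<beta>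
      using that fld unfolding Imp_iff by blast
    have ex: "Exists UNIV \<alpha> r" if "\<And>s. (s, q) \<in> R \<Longrightarrow> \<alpha> a s" "(r, q) \<in> R"
      for \<alpha> :: "nat \<Rightarrow> 'p sentence" and a r
      using that by (intro ExistsI[of a]) (auto intro: trans_R)
    have 1: "((i, j) \<^bold>\<in> F \<^bold>\<longrightarrow> \<phi> i \<^bold>\<and> Ground (j < card V)) q" for i j
      by (rule imp) (use f fld Mem_F dec in \<open>auto simp: Conj_def Ground_def bij_betw_def\<close>)
    have 2: "(\<phi> i \<^bold>\<longrightarrow> Exists UNIV (\<lambda>j. (i, j) \<^bold>\<in> F)) q" for i
      by (rule imp, rule ex[of _ "f i"]) (use fld Mem_F dec in auto)
    have 3: "Exists UNIV (\<lambda>i. (i, j) \<^bold>\<in> F) q" if "j \<in> {..<card V}" for j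
    proof -
      have "j \<in> f ` V"
        using f that by (simp add: bij_betw_def)
      then obtain i where i: "i \<in> V" "j = f i"
        by blast
      show ?thesis
        by (rule ex[OF _ q', of _ i]) (use i fld Mem_F in auto)
    qed
    have 4: "((i, j) \<^bold>\<in> F \<^bold>\<and> (i, j') \<^bold>\<in> F \<^bold>\<longrightarrow> Ground (j = j')) q" for i j j'
      by (rule imp) (use fld Mem_F in \<open>auto simp: Conj_def Ground_def\<close>)
    have 5: "((i, j) \<^bold>\<in> F \<^bold>\<and> (i', j) \<^bold>\<in> F \<^bold>\<longrightarrow> Ground (i = i')) q" for i i' j
      by (rule imp) (use f fld Mem_F in \<open>auto simp: Conj_def Ground_def bij_betw_def inj_on_def\<close>)
    show ?thesis
      unfolding Bijection_def Conj_def Forall_def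
      by (intro conjI ballI 1[unfolded Conj_def] 2 3 4[unfolded Conj_def] 5[unfolded Conj_def])
  qed
  then have "Exists_subset UNIV (\<lambda>F. Bijection F \<phi> (card V)) q" if "(q, p) \<in> R" for q
    unfolding Exists_subset_eq using F that trans_R by (intro ExistsI[of F]) blast+
  then show "Finite \<phi> p"
    unfolding Finite_def by (intro ExistsI[of "card V"]) auto
qed

end

section \<open>Thinning out uncountable families\<close>

lemma uncountable_fibre:
  assumes "uncountable X" "countable (f ` X)"
  obtains c where "uncountable {x \<in> X. f x = c}"
proof -
  have "X = (\<Union>c \<in> f ` X. {x \<in> X. f x = c})"
    by auto
  then show thesis
    using assms that by (metis (no_types, lifting) countable_UN)
qed

text \<open>A weakening of "injective with image of order type at most \<open>\<omega>\<^sub>1\<close>" that allows countable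
  fibres and passes to subsets.\<close>

definition countable_segments :: "'k rel \<Rightarrow> ('a \<Rightarrow> 'k) \<Rightarrow> 'a set \<Rightarrow> bool" where
  "countable_segments r f X \<longleftrightarrow> (\<forall>z\<in>X. countable {x \<in> X. (f x, f z) \<in> r})"

lemma countable_segments_subset:
  "countable_segments r f X \<Longrightarrow> Y \<subseteq> X \<Longrightarrow> countable_segments r f Y"
  unfolding countable_segments_def
  by (smt (verit) Collect_mono countable_subset subset_iff)

text \<open>If no fibre of \<open>f\<close> is uncountable, cut \<open>X\<close> off at the least value with uncountably many
  points of \<open>X\<close> below it; the values of \<open>f\<close> on what remains have order type \<open>\<omega>\<^sub>1\<close>, up to
  countable multiplicities.\<close>

lemma uncountable_thin_out:
  assumes r: "Well_order r" and f: "f ` X \<subseteq> Field r" and X: "uncountable X"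
  obtains Y where "Y \<subseteq> X" "uncountable Y" "(\<exists>c. \<forall>x\<in>Y. f x = c) \<or> countable_segments r f Y"
proof (cases "\<exists>c. uncountable {x \<in> X. f x = c}")
  case True
  then obtain c where "uncountable {x \<in> X. f x = c}" ..
  then show thesis
    by (intro that[of "{x \<in> X. f x = c}"]) auto
next
  case fibres: False
  show thesis
  proof (cases "countable_segments r f X")
    case True
    then show thesis
      using X that by blast
  next
    case False
    interpret wo_rel r
      using r by (simp add: wo_rel_def)
    define B where "B = {f z | z. z \<in> X \<and> uncountable {x \<in> X. (f x, f z) \<in> r}}"
    have B: "B \<subseteq> Field r" "B \<noteq> {}"
      using False f by (auto simp: B_def countable_segments_def)
    define b where "b = minim B"
    have "b \<in> B"
      using B minim_in by (auto simp: b_def)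
    then have seg: "uncountable {x \<in> X. (f x, b) \<in> r}"
      by (auto simp: B_def)
    define Y where "Y = {x \<in> X. (f x, b) \<in> r} - {x \<in> X. f x = b}"
    have Y: "uncountable Y"
      unfolding Y_def using seg fibres by (intro uncountable_minus_countable) auto
    have "countable {x \<in> Y. (f x, f z) \<in> r}" if z: "z \<in> Y" for z
    proof (rule ccontr)
      assume "uncountable {x \<in> Y. (f x, f z) \<in> r}"
      then have "uncountable {x \<in> X. (f x, f z) \<in> r}"
        by (rule contrapos_nn) (auto simp: Y_def elim: countable_subset[rotated])
      then have "f z \<in> B"
        using z by (auto simp: B_def Y_def)
      then have "(b, f z) \<in> r"
        using minim_least B by (auto simp: b_def)
      then show False
        using z ANTISYM by (auto simp: Y_def antisym_def)
    qed
    then show thesis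
      using Y that[of Y] by (auto simp: Y_def countable_segments_def)
  qed
qed

text \<open>Both alternatives pass to subsets, so finitely many functions can be treated in turn.\<close>

lemma uncountable_thin_out_finite:
  assumes r: "Well_order r" and X: "uncountable X"
    and N: "finite N" "\<And>i. i \<in> N \<Longrightarrow> f i ` X \<subseteq> Field r"
  obtains Y where "Y \<subseteq> X" "uncountable Y"
    "\<And>i. i \<in> N \<Longrightarrow> (\<exists>c. \<forall>x\<in>Y. f i x = c) \<or> countable_segments r (f i) Y"
proof -
  have "\<exists>Y\<subseteq>X. uncountable Y \<and>
    (\<forall>i\<in>N. (\<exists>c. \<forall>x\<in>Y. f i x = c) \<or> countable_segments r (f i) Y)"
    using N
  proof (induction N rule: finite_induct)
    case empty
    then show ?case
      using X by blast
  next
    case (insert i N)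
    then obtain Y where Y: "Y \<subseteq> X" "uncountable Y"
      "\<forall>i\<in>N. (\<exists>c. \<forall>x\<in>Y. f i x = c) \<or> countable_segments r (f i) Y"
      by auto
    have "f i ` Y \<subseteq> Field r"
      using insert.prems Y(1) by blast
    then obtain Z where Z: "Z \<subseteq> Y" "uncountable Z"
      "(\<exists>c. \<forall>x\<in>Z. f i x = c) \<or> countable_segments r (f i) Z"
      using uncountable_thin_out[OF r _ Y(2)] by metis
    have "(\<exists>c. \<forall>x\<in>Z. f j x = c) \<or> countable_segments r (f j) Z" if "j \<in> N" for j
      using Y(3) that Z(1) countable_segments_subset by (meson subsetD)
    then show ?case
      using Y(1) Z by (intro exI[of _ Z]) auto
  qed
  then show thesis
    using that by auto
qed

text \<open>If there were no such \<open>k\<close>, then for every \<open>k\<close> deleting countably many members from \<open>I\<close> or from \<open>J\<close> would remove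
  all cases of \<open>k \<in> B x\<close>, or all cases of \<open>k \<notin> B y\<close>. Doing so for all \<open>k\<close> leaves uncountable sets
  \<open>I'\<close>, \<open>J'\<close> with \<open>B x \<subseteq> B y\<close> throughout.\<close>

lemma uncountable_split:
  fixes B :: "'a \<Rightarrow> nat set"
  assumes IJ: "uncountable I" "uncountable J"
    and sub: "\<And>I' J'. \<lbrakk>I' \<subseteq> I; J' \<subseteq> J; uncountable I'; uncountable J'\<rbrakk>
      \<Longrightarrow> \<exists>x\<in>I'. \<exists>y\<in>J'. \<not> B x \<subseteq> B y"
  shows "\<exists>k. uncountable {x \<in> I. k \<in> B x} \<and> uncountable {y \<in> J. k \<notin> B y}"
proof (rule ccontr)
  assume "\<not> ?thesis"
  then have no: "countable {x \<in> I. k \<in> B x} \<or> countable {y \<in> J. k \<notin> B y}" for k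
    by blast
  define K where "K = {k. countable {x \<in> I. k \<in> B x}}"
  define I' where "I' = I - (\<Union>k\<in>K. {x \<in> I. k \<in> B x})"
  define J' where "J' = J - (\<Union>k\<in>-K. {y \<in> J. k \<notin> B y})"
  have "uncountable I'"
    unfolding I'_def by (intro uncountable_minus_countable[OF IJ(1)] countable_UN) (auto simp: K_def)
  moreover have "countable {y \<in> J. k \<notin> B y}" if "k \<in> - K" for k
    using no[of k] that by (simp add: K_def)
  then have "uncountable J'"
    unfolding J'_def by (intro uncountable_minus_countable[OF IJ(2)] countable_UN) auto
  ultimately obtain x y k where "x \<in> I'" "y \<in> J'" "k \<in> B x" "k \<notin> B y"
    using sub[of I' J'] by (auto simp: I'_def J'_def)
  then show False
    by (cases "k \<in> K") (auto simp: I'_def J'_def)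
qed

text \<open>Since the sets of the previous lemma are again uncountable, it can be iterated over finitely
  many families, and for each of them in both directions.\<close>

lemma uncountable_split_finite:
  fixes B :: "'i \<Rightarrow> 'a \<Rightarrow> nat set"
  assumes X: "uncountable X" and N: "finite N"
    and sub: "\<And>i I J. \<lbrakk>i \<in> N; I \<subseteq> X; J \<subseteq> X; uncountable I; uncountable J\<rbrakk>
      \<Longrightarrow> \<exists>x\<in>I. \<exists>y\<in>J. \<not> B i x \<subseteq> B i y"
  shows "\<exists>I J. I \<subseteq> X \<and> J \<subseteq> X \<and> uncountable I \<and> uncountable J \<and>
    (\<forall>i\<in>N. \<forall>x\<in>I. \<forall>y\<in>J. \<not> B i x \<subseteq> B i y \<and> \<not> B i y \<subseteq> B i x)"
  using N sub
proof (induction N rule: finite_induct)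
  case empty
  then show ?case
    using X by blast
next
  case (insert i N)
  have "\<exists>I J. I \<subseteq> X \<and> J \<subseteq> X \<and> uncountable I \<and> uncountable J \<and>
    (\<forall>i\<in>N. \<forall>x\<in>I. \<forall>y\<in>J. \<not> B i x \<subseteq> B i y \<and> \<not> B i y \<subseteq> B i x)"
    by (rule insert.IH, rule insert.prems) auto
  then obtain I J where IJ: "I \<subseteq> X" "J \<subseteq> X" "uncountable I" "uncountable J"
    and old: "\<forall>i\<in>N. \<forall>x\<in>I. \<forall>y\<in>J. \<not> B i x \<subseteq> B i y \<and> \<not> B i y \<subseteq> B i x"
    by (elim exE conjE)
  have sub': "\<exists>x\<in>I'. \<exists>y\<in>J'. \<not> B i x \<subseteq> B i y"
    if "I' \<subseteq> X" "J' \<subseteq> X" "uncountable I'" "uncountable J'" for I' J'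
    by (rule insert.prems) (use that in auto)
  have "\<exists>x\<in>I'. \<exists>y\<in>J'. \<not> B i x \<subseteq> B i y"
    if "I' \<subseteq> I" "J' \<subseteq> J" "uncountable I'" "uncountable J'" for I' J'
    using that IJ(1,2) by (intro sub') auto
  then obtain k where k: "uncountable {x \<in> I. k \<in> B i x}" "uncountable {y \<in> J. k \<notin> B i y}"
    using uncountable_split[OF IJ(3,4), of "B i"] by auto
  have "\<exists>y\<in>J'. \<exists>x\<in>I'. \<not> B i y \<subseteq> B i x"
    if "J' \<subseteq> {y \<in> J. k \<notin> B i y}" "I' \<subseteq> {x \<in> I. k \<in> B i x}" "uncountable J'" "uncountable I'"
    for I' J'
    using that IJ(1,2) by (intro sub') auto
  then obtain l where l: "uncountable {y \<in> {y \<in> J. k \<notin> B i y}. l \<in> B i y}"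
    "uncountable {x \<in> {x \<in> I. k \<in> B i x}. l \<notin> B i x}"
    using uncountable_split[OF k(2,1), of "B i"] by auto
  show ?case
  proof (intro exI conjI)
    show "uncountable {x \<in> {x \<in> I. k \<in> B i x}. l \<notin> B i x}"
      "uncountable {y \<in> {y \<in> J. k \<notin> B i y}. l \<in> B i y}"
      using l by auto
  qed (use IJ old in auto)
qed

section \<open>Finite sets of members of a tower\<close>

lemma finite_has_least:
  assumes "Linear_order r" "finite F" "F \<noteq> {}" "F \<subseteq> Field r"
  shows "\<exists>m\<in>F. \<forall>x\<in>F. (m, x) \<in> r"
  using assms(2-4)
proof (induction F rule: finite_ne_induct)
  case (singleton x)
  then show ?case
    using assms(1) by (auto simp: order_on_defs refl_on_def)
next
  case (insert x F)
  then obtain m where m: "m \<in> F" "\<forall>y\<in>F. (m, y) \<in> r"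
    by auto
  have "(x, x) \<in> r"
    using assms(1) insert.prems by (auto simp: order_on_defs refl_on_def)
  moreover have "(x, m) \<in> r \<or> (m, x) \<in> r"
    using assms(1) insert.prems m(1) calculation
    by (cases "x = m") (auto simp: order_on_defs total_on_def)
  moreover have "trans r"
    using assms(1) by (simp add: order_on_defs)
  ultimately show ?case
    using m by (metis insert_iff transD)
qed

locale infinite_tower =
  fixes \<kappa> :: "'k rel" and T :: "'k \<Rightarrow> nat set"
  assumes card: "Card_order \<kappa>" and inf: "infinite (Field \<kappa>)"
    and tower: "tower \<kappa> T" and inf_T: "\<And>\<alpha>. \<alpha> \<in> Field \<kappa> \<Longrightarrow> infinite (T \<alpha>)"
begin

lemma well_order: "Well_order \<kappa>"
  using card by (simp add: card_order_on_def)

lemma linear_order: "Linear_order \<kappa>"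
  using well_order by (simp add: well_order_on_def)

lemma finite_diff_iff:
  "\<alpha> \<in> Field \<kappa> \<Longrightarrow> \<beta> \<in> Field \<kappa> \<Longrightarrow> finite (T \<alpha> - T \<beta>) \<longleftrightarrow> (\<alpha>, \<beta>) \<in> \<kappa>"
  using tower by (auto simp: tower_def)

text \<open>The smallest of the given sets is almost contained in each of the others.\<close>

lemma infinite_Inter:
  assumes F: "finite F" "F \<noteq> {}" "F \<subseteq> Field \<kappa>"
  shows "infinite (\<Inter>\<alpha>\<in>F. T \<alpha>)"
proof -
  obtain m where m: "m \<in> F" "\<forall>x\<in>F. (m, x) \<in> \<kappa>"
    using finite_has_least[OF linear_order F] by blast
  have "finite (\<Union>\<alpha>\<in>F. T m - T \<alpha>)"
    using F m finite_diff_iff by blast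
  then have "infinite (T m - (\<Union>\<alpha>\<in>F. T m - T \<alpha>))"
    using inf_T m(1) F(3) by (metis Diff_infinite_finite subsetD)
  then show ?thesis
    by (rule contrapos_nn) (auto elim: finite_subset[rotated])
qed

text \<open>As \<open>\<kappa>\<close> is a limit, some \<open>T \<gamma>\<close> lies above all the given sets, and it exceeds the largest
  of them by infinitely many points.\<close>

lemma infinite_Compl_Union:
  assumes F: "finite F" "F \<noteq> {}" "F \<subseteq> Field \<kappa>"
  shows "infinite (- (\<Union>\<alpha>\<in>F. T \<alpha>))"
proof -
  obtain m where m: "m \<in> F" "\<forall>x\<in>F. (x, m) \<in> \<kappa>"
    using finite_has_least[of "\<kappa>\<inverse>" F] linear_order F by auto
  obtain \<gamma> where \<gamma>: "\<gamma> \<in> Field \<kappa>" "m \<noteq> \<gamma>" "(m, \<gamma>) \<in> \<kappa>"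
    using infinite_Card_order_limit[OF card inf] m(1) F(3) by blast
  have "(\<gamma>, m) \<notin> \<kappa>"
    using \<gamma> linear_order by (auto simp: order_on_defs antisym_def)
  then have "infinite (T \<gamma> - T m)"
    using finite_diff_iff \<gamma>(1) m(1) F(3) by blast
  moreover have "finite (\<Union>\<alpha>\<in>F. T \<alpha> - T m)"
    using F m finite_diff_iff by blast
  ultimately have "infinite (T \<gamma> - T m - (\<Union>\<alpha>\<in>F. T \<alpha> - T m))"
    by (metis Diff_infinite_finite)
  then show ?thesis
    by (rule contrapos_nn) (auto elim: finite_subset[rotated])
qed

section \<open>The forcing notion\<close>

text \<open>A condition is a finite relation. Its domain consists of the indices \<open>\<alpha>\<close> for which it has
  fixed \<open>T'\<^sub>\<alpha>\<close>, and \<open>p `` {\<alpha>}\<close> is the set of the points at which \<open>T'\<^sub>\<alpha>\<close> is to differ from \<open>T\<^sub>\<alpha>\<close>.\<close>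

definition val :: "('k \<times> nat) set \<Rightarrow> 'k \<Rightarrow> nat set" where
  "val p \<alpha> = sym_diff (T \<alpha>) (p `` {\<alpha>})"

definition swap :: "'k \<Rightarrow> nat set \<Rightarrow> bool" where
  "swap \<alpha> D \<longleftrightarrow> (\<exists>r a. r \<in> T \<alpha> \<and> a \<notin> T \<alpha> \<and> D = {r, a})"

definition conds :: "('k \<times> nat) set set" where
  "conds = {p. finite p \<and> Domain p \<subseteq> Field \<kappa> \<and> (\<forall>\<alpha>\<in>Domain p. swap \<alpha> (p `` {\<alpha>})) \<and>
     (\<forall>\<alpha>\<in>Domain p. \<forall>\<beta>\<in>Domain p. \<alpha> \<noteq> \<beta> \<longrightarrow> \<not> val p \<alpha> \<subseteq> val p \<beta>)}"

definition ext :: "('k \<times> nat) set rel" where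
  "ext = {(q, p). q \<in> conds \<and> p \<in> conds \<and> p \<subseteq> q}"

definition nam :: "'k \<Rightarrow> (nat, ('k \<times> nat) set) nm" where
  "nam \<alpha> = {(n, p). p \<in> conds \<and> \<alpha> \<in> Domain p \<and> n \<in> val p \<alpha>}"

lemma condsD:
  assumes "p \<in> conds"
  shows "finite p" "Domain p \<subseteq> Field \<kappa>" "\<And>\<alpha>. \<alpha> \<in> Domain p \<Longrightarrow> swap \<alpha> (p `` {\<alpha>})"
    "\<And>\<alpha> \<beta>. \<lbrakk>\<alpha> \<in> Domain p; \<beta> \<in> Domain p; \<alpha> \<noteq> \<beta>\<rbrakk> \<Longrightarrow> \<not> val p \<alpha> \<subseteq> val p \<beta>"
  using assms by (auto simp: conds_def)

lemma empty_conds: "{} \<in> conds"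
  by (simp add: conds_def)

lemma Field_ext: "Field ext = conds"
  by (auto simp: ext_def Field_def)

lemma swap_subset_eq: "\<lbrakk>swap \<alpha> D; swap \<alpha> E; D \<subseteq> E\<rbrakk> \<Longrightarrow> D = E"
  by (auto simp: swap_def)

text \<open>A column of a condition is full, so stronger conditions do not change it.\<close>

lemma column_mono:
  assumes "(q, p) \<in> ext" "\<alpha> \<in> Domain p"
  shows "q `` {\<alpha>} = p `` {\<alpha>}"
proof -
  have "p `` {\<alpha>} \<subseteq> q `` {\<alpha>}" "\<alpha> \<in> Domain q"
    using assms by (auto simp: ext_def)
  moreover have "swap \<alpha> (p `` {\<alpha>})" "swap \<alpha> (q `` {\<alpha>})"
    using assms condsD(3) calculation by (auto simp: ext_def)
  ultimately show ?thesis
    using swap_subset_eq by metis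
qed

lemma ext_conds: "(q, p) \<in> ext \<Longrightarrow> q \<in> conds"
  by (simp add: ext_def)

lemma val_mono: "(q, p) \<in> ext \<Longrightarrow> \<alpha> \<in> Domain p \<Longrightarrow> val q \<alpha> = val p \<alpha>"
  by (simp add: val_def column_mono)

lemma Domain_mono: "(q, p) \<in> ext \<Longrightarrow> \<alpha> \<in> Domain p \<Longrightarrow> \<alpha> \<in> Domain q"
  by (auto simp: ext_def)

text \<open>A new index can always be added: the removed point \<open>r\<close>, which belongs to all the other sets,
  keeps them from being subsets of the new one, and the added point \<open>a\<close>, which belongs to none of
  them, keeps the new set from being a subset of any of them.\<close>

lemma conds_dense:
  assumes p: "p \<in> conds" and \<alpha>: "\<alpha> \<in> Field \<kappa>"
  obtains q where "(q, p) \<in> ext" "\<alpha> \<in> Domain q"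
proof (cases "\<alpha> \<in> Domain p")
  case True
  then show thesis
    using that[of p] p by (auto simp: ext_def)
next
  case False
  let ?F = "insert \<alpha> (Domain p)"
  have F: "finite ?F" "?F \<noteq> {}" "?F \<subseteq> Field \<kappa>" "finite (Range p)"
    using condsD[OF p] \<alpha> by (auto simp: finite_Domain finite_Range)
  have "infinite ((\<Inter>\<beta>\<in>?F. T \<beta>) - Range p)" "infinite (- (\<Union>\<beta>\<in>?F. T \<beta>) - Range p)"
    using infinite_Inter[OF F(1-3)] infinite_Compl_Union[OF F(1-3)] F(4)
    by (simp_all only: Diff_infinite_finite not_False_eq_True)
  then obtain r a where r: "r \<in> (\<Inter>\<beta>\<in>?F. T \<beta>) - Range p" and a: "a \<in> - (\<Union>\<beta>\<in>?F. T \<beta>) - Range p"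
    by (metis ex_in_conv finite.emptyI)
  define q where "q = {(\<alpha>, r), (\<alpha>, a)} \<union> p"
  have dom: "Domain q = ?F"
    by (auto simp: q_def)
  have col: "q `` {\<alpha>} = {r, a}" "\<And>\<beta>. \<beta> \<noteq> \<alpha> \<Longrightarrow> q `` {\<beta>} = p `` {\<beta>}"
    using False by (auto simp: q_def)
  have val_p: "val q \<beta> = val p \<beta>" if "\<beta> \<in> Domain p" for \<beta>
    using that False col by (metis val_def)
  have "r \<in> val p \<beta>" "a \<notin> val p \<beta>" if "\<beta> \<in> Domain p" for \<beta>
    using r a that by (auto simp: val_def)
  moreover have "r \<notin> val q \<alpha>" "a \<in> val q \<alpha>"
    using r a by (auto simp: val_def col)
  ultimately have "\<not> val q \<beta> \<subseteq> val q \<gamma>" if "\<beta> \<in> ?F" "\<gamma> \<in> ?F" "\<beta> \<noteq> \<gamma>" for \<beta> \<gamma>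
    using that val_p condsD(4)[OF p] by (metis insertE subsetD)
  moreover have "swap \<beta> (q `` {\<beta>})" if "\<beta> \<in> ?F" for \<beta>
  proof (cases "\<beta> = \<alpha>")
    case True
    then show ?thesis
      using r a col by (auto simp: swap_def)
  next
    case False
    then show ?thesis
      using that condsD(3)[OF p] col by (metis insertE)
  qed
  ultimately have "q \<in> conds"
    using F condsD(1)[OF p] unfolding conds_def dom by (auto simp: q_def)
  then show thesis
    using that[of q] p dom by (auto simp: ext_def q_def)
qed

sublocale forcing ext
proof
  show "preorder_on (Field ext) ext"
    unfolding Field_ext by (auto simp: preorder_on_def refl_on_def trans_def ext_def)
  show "Field ext \<noteq> {}"
    using empty_conds by (auto simp: Field_ext)
qed

end

section \<open>The countable chain condition\<close>

context infinite_tower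
begin

lemma union_conds:
  assumes pq: "p \<in> conds" "q \<in> conds"
    and same: "\<And>\<alpha>. \<alpha> \<in> Domain p \<Longrightarrow> \<alpha> \<in> Domain q \<Longrightarrow> p `` {\<alpha>} = q `` {\<alpha>}"
    and cross: "\<And>\<alpha> \<beta>. \<lbrakk>\<alpha> \<in> Domain p; \<beta> \<in> Domain q; \<alpha> \<noteq> \<beta>\<rbrakk>
      \<Longrightarrow> \<not> val p \<alpha> \<subseteq> val q \<beta> \<and> \<not> val q \<beta> \<subseteq> val p \<alpha>"
  shows "p \<union> q \<in> conds"
proof -
  have col: "(p \<union> q) `` {\<alpha>} = p `` {\<alpha>}" if "\<alpha> \<in> Domain p" for \<alpha>
    using same[OF that] by (cases "\<alpha> \<in> Domain q") auto
  have col': "(p \<union> q) `` {\<alpha>} = q `` {\<alpha>}" if "\<alpha> \<in> Domain q" for \<alpha>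
    using same[OF _ that] by (cases "\<alpha> \<in> Domain p") auto
  have vals: "val (p \<union> q) \<alpha> = val p \<alpha>" if "\<alpha> \<in> Domain p" for \<alpha>
    using col[OF that] by (simp add: val_def)
  have vals': "val (p \<union> q) \<alpha> = val q \<alpha>" if "\<alpha> \<in> Domain q" for \<alpha>
    using col'[OF that] by (simp add: val_def)
  have "swap \<alpha> ((p \<union> q) `` {\<alpha>})" if "\<alpha> \<in> Domain p \<union> Domain q" for \<alpha>
    using that condsD(3)[OF pq(1)] condsD(3)[OF pq(2)] col col' by (metis Un_iff)
  moreover have "\<not> val (p \<union> q) \<alpha> \<subseteq> val (p \<union> q) \<beta>"
    if "\<alpha> \<in> Domain p \<union> Domain q" "\<beta> \<in> Domain p \<union> Domain q" "\<alpha> \<noteq> \<beta>" for \<alpha> \<beta>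
    using that condsD(4)[OF pq(1)] condsD(4)[OF pq(2)] cross vals vals' by (metis Un_iff)
  ultimately show ?thesis
    using condsD(1,2)[OF pq(1)] condsD(1,2)[OF pq(2)] unfolding conds_def by (simp add: Domain_Un_eq)
qed

text \<open>Modified by a fixed finite set, the tower has no uncountable family of inclusions from \<open>I\<close>
  to \<open>J\<close>: some index from \<open>I\<close> is above some index from \<open>J\<close>, and there the difference is infinite.\<close>

lemma countable_segments_not_subset:
  assumes f: "f ` X \<subseteq> Field \<kappa>" and seg: "countable_segments \<kappa> f X" and D: "finite D"
    and IJ: "I \<subseteq> X" "J \<subseteq> X" "uncountable I" "uncountable J"
  shows "\<exists>x\<in>I. \<exists>y\<in>J. \<not> sym_diff (T (f x)) D \<subseteq> sym_diff (T (f y)) D"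
proof -
  obtain y where y: "y \<in> J"
    using IJ(4) by fastforce
  have "countable {x \<in> I. (f x, f y) \<in> \<kappa>}"
    using seg y IJ(1,2) unfolding countable_segments_def
    by (smt (verit) Collect_mono countable_subset subset_iff)
  then obtain x where x: "x \<in> I" "(f x, f y) \<notin> \<kappa>"
    using IJ(3) by (metis (mono_tags, lifting) Collect_cong Collect_mem_eq)
  then have "infinite (T (f x) - T (f y))"
    using finite_diff_iff f IJ(1,2) y by blast
  then have "infinite (T (f x) - T (f y) - D)"
    using D by simp
  then obtain k where "k \<in> T (f x) - T (f y) - D"
    using infinite_imp_nonempty by blast
  then have "\<not> sym_diff (T (f x)) D \<subseteq> sym_diff (T (f y)) D"
    by auto
  then show ?thesis
    using x(1) y by blast
qed

text \<open>The domains are enumerated, and the thinning out and splitting of uncountable families are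
  applied to the coordinates of these enumerations.\<close>

lemma compatible_in_uncountable:
  assumes A: "A \<subseteq> conds" "uncountable A"
  shows "\<exists>p\<in>A. \<exists>q\<in>A. p \<noteq> q \<and> compatible p q"
proof -
  have "\<exists>l. distinct l \<and> set l = Domain p" if "p \<in> A" for p
    using A condsD(1) that by (meson finite_Domain finite_distinct_list subsetD)
  then obtain l where l: "\<And>p. p \<in> A \<Longrightarrow> distinct (l p) \<and> set (l p) = Domain p"
    by metis
  have "\<exists>k. k \<in> val p \<alpha> - val p \<beta>"
    if "p \<in> A" "\<alpha> \<in> Domain p" "\<beta> \<in> Domain p" "\<alpha> \<noteq> \<beta>" for p \<alpha> \<beta>
    using condsD(4) that A(1) by blast
  then obtain w where w: "\<And>p \<alpha> \<beta>. \<lbrakk>p \<in> A; \<alpha> \<in> Domain p; \<beta> \<in> Domain p; \<alpha> \<noteq> \<beta>\<rbrakk>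
      \<Longrightarrow> w p \<alpha> \<beta> \<in> val p \<alpha> - val p \<beta>"
    by metis
  \<comment> \<open>The data to be made equal: the columns, and for any two of them a witness of non-inclusion.
    They are coded as lists so that there are only countably many possibilities.\<close>
  define type where "type p =
    (map (\<lambda>\<alpha>. sorted_list_of_set (p `` {\<alpha>})) (l p), map (\<lambda>\<alpha>. map (w p \<alpha>) (l p)) (l p))" for p
  obtain c where c: "uncountable {p \<in> A. type p = c}"
    using uncountable_fibre[OF A(2), of type] by auto
  define X where "X = {p \<in> A. type p = c}"
  define n where "n = length (fst c)"
  define D where "D i = set (fst c ! i)" for i
  define W where "W i j = snd c ! i ! j" for i j
  define idx where "idx i p = l p ! i" for i p
  have X: "uncountable X" "X \<subseteq> A"
    using c by (auto simp: X_def)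
  have len: "length (l p) = n" if "p \<in> X" for p
    using that by (auto simp: X_def n_def type_def)
  have dom: "Domain p = (\<lambda>i. idx i p) ` {..<n}" if "p \<in> X" for p
    using l[of p] that X(2) len[OF that] by (auto simp: idx_def set_conv_nth)
  have idx_in: "idx i p \<in> Domain p" if "p \<in> X" "i < n" for i p
    using dom that by auto
  have idx_eq: "idx i p = idx j p \<longleftrightarrow> i = j" if "p \<in> X" "i < n" "j < n" for i j p
    using l[of p] that X(2) len by (auto simp: idx_def nth_eq_iff_index_eq)
  have idx_Field: "idx i p \<in> Field \<kappa>" if "p \<in> X" "i < n" for i p
    using idx_in[OF that] that X(2) A(1) condsD(2) by blast
  have col: "p `` {idx i p} = D i" if "p \<in> X" "i < n" for i p
  proof -
    have "finite p"
      using that X(2) A(1) condsD(1) by blast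
    then have "finite (p `` {idx i p})"
      by (simp add: finite_Image)
    moreover have "fst c = map (\<lambda>\<alpha>. sorted_list_of_set (p `` {\<alpha>})) (l p)"
      using that by (auto simp: X_def type_def)
    ultimately show ?thesis
      using that len by (simp add: D_def idx_def)
  qed
  have val_idx: "val p (idx i p) = sym_diff (T (idx i p)) (D i)" if "p \<in> X" "i < n" for i p
    by (simp add: val_def col[OF that])
  have W: "W i j \<in> val p (idx i p) - val p (idx j p)" if "p \<in> X" "i < n" "j < n" "i \<noteq> j" for i j p
  proof -
    have "snd c = map (\<lambda>\<alpha>. map (w p \<alpha>) (l p)) (l p)"
      using that by (auto simp: X_def type_def)
    then have "W i j = w p (idx i p) (idx j p)"
      using that len by (simp add: W_def idx_def)
    then show ?thesis
      using w idx_in idx_eq that X(2) by (metis subsetD)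
  qed
  obtain Y where Y: "Y \<subseteq> X" "uncountable Y"
    and thin: "\<And>i. i < n \<Longrightarrow> (\<exists>c. \<forall>p\<in>Y. idx i p = c) \<or> countable_segments \<kappa> (idx i) Y"
  proof (rule uncountable_thin_out_finite[OF well_order X(1), of "{..<n}" idx])
    show "idx i ` X \<subseteq> Field \<kappa>" if "i \<in> {..<n}" for i
      using that idx_Field by auto
  qed auto
  define N where "N = {i. i < n \<and> countable_segments \<kappa> (idx i) Y}"
  define V where "V i p = sym_diff (T (idx i p)) (D i)" for i p
  have fam: "\<exists>p\<in>I. \<exists>q\<in>J. \<not> V i p \<subseteq> V i q"
    if "i \<in> N" "I \<subseteq> Y" "J \<subseteq> Y" "uncountable I" "uncountable J" for i I J
    unfolding V_def
  proof (rule countable_segments_not_subset[OF _ _ _ that(2-5)])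
    show "idx i ` Y \<subseteq> Field \<kappa>"
      using that(1) idx_Field Y(1) by (auto simp: N_def)
  qed (use that(1) in \<open>auto simp: N_def D_def\<close>)
  have "finite N"
    by (simp add: N_def)
  have "\<exists>I J. I \<subseteq> Y \<and> J \<subseteq> Y \<and> uncountable I \<and> uncountable J \<and>
      (\<forall>i\<in>N. \<forall>p\<in>I. \<forall>q\<in>J. \<not> V i p \<subseteq> V i q \<and> \<not> V i q \<subseteq> V i p)"
    by (rule uncountable_split_finite[OF Y(2) \<open>finite N\<close>], rule fam) auto
  then obtain I J where IJ: "I \<subseteq> Y" "J \<subseteq> Y" "uncountable I" "uncountable J"
    and split: "\<forall>i\<in>N. \<forall>p\<in>I. \<forall>q\<in>J. \<not> V i p \<subseteq> V i q \<and> \<not> V i q \<subseteq> V i p"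
    by (elim exE conjE)
  obtain p where p: "p \<in> I"
    using IJ(3) by fastforce
  have pX: "p \<in> X" "p \<in> Y"
    using p IJ(1) Y(1) by auto
  \<comment> \<open>The two domains may meet only in coordinates that are constant on \<open>Y\<close>. Each other
    coordinate of \<open>q\<close> avoids the finitely many indices of \<open>p\<close> for all but countably many \<open>q\<close>.\<close>
  define bad where "bad = insert p (\<Union>i\<in>N. \<Union>j\<in>{..<n}. {q \<in> J. idx i q = idx j p})"
  have "countable {q \<in> J. idx i q = \<gamma>}" if i: "i \<in> N" for i \<gamma>
  proof (cases "{q \<in> J. idx i q = \<gamma>} = {}")
    case True
    then show ?thesis
      by (simp only: countable_empty)
  next
    case False
    then obtain q where q: "q \<in> J" "idx i q = \<gamma>"
      by auto
    have "\<gamma> \<in> Field \<kappa>"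
      using q i idx_Field IJ(2) Y(1) by (auto simp: N_def)
    then have "(\<gamma>, \<gamma>) \<in> \<kappa>"
      using linear_order by (auto simp: order_on_defs refl_on_def)
    then have "{q \<in> J. idx i q = \<gamma>} \<subseteq> {x \<in> Y. (idx i x, idx i q) \<in> \<kappa>}"
      using q IJ(2) by auto
    moreover have "countable {x \<in> Y. (idx i x, idx i q) \<in> \<kappa>}"
      using i q(1) IJ(2) by (auto simp: N_def countable_segments_def)
    ultimately show ?thesis
      by (rule countable_subset)
  qed
  then have "countable bad"
    using \<open>finite N\<close> unfolding bad_def by (intro countable_insert countable_UN) (auto simp: countable_finite)
  then have "uncountable (J - bad)"
    using IJ(4) by (intro uncountable_minus_countable)
  then obtain q where q: "q \<in> J" "q \<notin> bad"
    by (metis DiffE countable_empty ex_in_conv)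
  have qX: "q \<in> X" "q \<in> Y"
    using q IJ(2) Y(1) by auto
  have const: "idx i p = idx i q" if "i < n" "i \<notin> N" for i
    using thin[OF that(1)] that pX(2) qX(2) by (auto simp: N_def)
  have meet: "i = j" if "i < n" "j < n" "idx i p = idx j q" for i j
  proof (cases "j \<in> N")
    case True
    then have "q \<in> bad"
      unfolding bad_def using q(1) that(1) that(3)[symmetric] by blast
    then show ?thesis
      using q(2) by contradiction
  next
    case False
    then have "idx i p = idx j p"
      using const[OF that(2)] that(3) by simp
    then show ?thesis
      using idx_eq[OF pX(1) that(1,2)] by blast
  qed
  have cross: "\<not> val p (idx i p) \<subseteq> val q (idx j q) \<and> \<not> val q (idx j q) \<subseteq> val p (idx i p)"
    if ij: "i < n" "j < n" "idx i p \<noteq> idx j q" for i j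
  proof (cases "i = j")
    case True
    then have "i \<in> N"
      using const ij by auto
    then show ?thesis
      using split p q(1) val_idx pX(1) qX(1) ij True by (simp add: V_def)
  next
    case False
    then show ?thesis
      using W[OF pX(1) ij(1,2)] W[OF qX(1) ij(1,2)] W[OF pX(1) ij(2,1)] W[OF qX(1) ij(2,1)] by auto
  qed
  have pq: "p \<in> conds" "q \<in> conds" "p \<in> A" "q \<in> A"
    using pX qX X(2) A(1) by auto
  have "p \<union> q \<in> conds"
  proof (rule union_conds[OF pq(1,2)])
    show "p `` {\<alpha>} = q `` {\<alpha>}" if \<alpha>: "\<alpha> \<in> Domain p" "\<alpha> \<in> Domain q" for \<alpha>
    proof -
      obtain i where i: "i < n" "\<alpha> = idx i p"
        using \<alpha>(1) unfolding dom[OF pX(1)] by blast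
      obtain j where j: "j < n" "\<alpha> = idx j q"
        using \<alpha>(2) unfolding dom[OF qX(1)] by blast
      have "i = j"
        using meet i j by metis
      then show ?thesis
        using col[OF pX(1) i(1)] col[OF qX(1) j(1)] i(2) j(2) by metis
    qed
  next
    show "\<not> val p \<alpha> \<subseteq> val q \<beta> \<and> \<not> val q \<beta> \<subseteq> val p \<alpha>"
      if "\<alpha> \<in> Domain p" "\<beta> \<in> Domain q" "\<alpha> \<noteq> \<beta>" for \<alpha> \<beta>
      using that cross unfolding dom[OF pX(1)] dom[OF qX(1)] by blast
  qed
  then have "compatible p q"
    unfolding compatible_def using pq by (auto simp: ext_def)
  moreover have "p \<noteq> q"
    using q(2) by (auto simp: bad_def)
  ultimately show ?thesis
    using pq by blast
qed

lemma ccc_ext: ccc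
  unfolding ccc_def Field_ext by (metis compatible_in_uncountable)

section \<open>The generic tower\<close>

notation Mem (infix \<open>\<^bold>\<in>\<close> 50)
notation Neg (\<open>\<^bold>\<not> _\<close> [40] 40)
notation Imp (infixr \<open>\<^bold>\<longrightarrow>\<close> 25)
notation Iff (infixr \<open>\<^bold>\<longleftrightarrow>\<close> 25)

lemma nam_names: "nam \<alpha> \<in> names UNIV"
  by (auto simp: nam_def names_def Field_ext)

lemma ext_dense2:
  assumes "p \<in> conds" "\<alpha> \<in> Field \<kappa>" "\<beta> \<in> Field \<kappa>"
  obtains q where "(q, p) \<in> ext" "\<alpha> \<in> Domain q" "\<beta> \<in> Domain q"
proof -
  obtain q where q: "(q, p) \<in> ext" "\<alpha> \<in> Domain q"
    using conds_dense assms by blast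
  then obtain r where r: "(r, q) \<in> ext" "\<beta> \<in> Domain r"
    using conds_dense assms(3) by (metis Field_ext FieldI1)
  show thesis
    using that[OF trans_R[OF r(1) q(1)] Domain_mono[OF r(1) q(2)] r(2)] .
qed

text \<open>A condition with \<open>\<alpha>\<close> in its domain decides \<open>T'\<^sub>\<alpha>\<close> completely, because no stronger condition
  changes that column.\<close>

lemma Mem_nam_iff:
  assumes p: "p \<in> conds" and \<alpha>: "\<alpha> \<in> Domain p"
  shows "(n \<^bold>\<in> nam \<alpha>) p \<longleftrightarrow> n \<in> val p \<alpha>"
proof
  assume "(n \<^bold>\<in> nam \<alpha>) p"
  moreover have "(p, p) \<in> ext"
    using p by (simp add: ext_def)
  ultimately obtain q r where q: "(q, p) \<in> ext" "(n, r) \<in> nam \<alpha>" "(q, r) \<in> ext"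
    unfolding Mem_def by blast
  then have "n \<in> val r \<alpha>" "\<alpha> \<in> Domain r"
    by (auto simp: nam_def)
  then show "n \<in> val p \<alpha>"
    using val_mono q(1,3) \<alpha> by metis
next
  assume "n \<in> val p \<alpha>"
  then have "(n, p) \<in> nam \<alpha>"
    using p \<alpha> by (simp add: nam_def)
  then show "(n \<^bold>\<in> nam \<alpha>) p"
    unfolding Mem_def using refl_R by (meson FieldI1)
qed

lemma Neg_Mem_nam_iff:
  assumes "p \<in> conds" "\<alpha> \<in> Domain p"
  shows "(\<^bold>\<not> n \<^bold>\<in> nam \<alpha>) p \<longleftrightarrow> n \<notin> val p \<alpha>"
proof -
  have "(n \<^bold>\<in> nam \<alpha>) q \<longleftrightarrow> n \<in> val p \<alpha>" if "(q, p) \<in> ext" for q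
    using Mem_nam_iff Domain_mono val_mono that assms by (metis Field_ext FieldI1)
  moreover have "(p, p) \<in> ext"
    using assms by (simp add: ext_def)
  ultimately show ?thesis
    unfolding Neg_def by blast
qed

lemma Finite_nam_diff_iff:
  assumes p: "p \<in> conds" and dom: "\<alpha> \<in> Domain p" "\<beta> \<in> Domain p"
  shows "Finite (In_diff (nam \<alpha>) (nam \<beta>)) p \<longleftrightarrow> (\<alpha>, \<beta>) \<in> \<kappa>"
proof -
  have "Finite (In_diff (nam \<alpha>) (nam \<beta>)) p \<longleftrightarrow> finite (val p \<alpha> - val p \<beta>)"
  proof (rule Finite_decided_iff)
    fix q i
    assume q: "(q, p) \<in> ext"
    then have "q \<in> conds" "\<alpha> \<in> Domain q" "\<beta> \<in> Domain q"
      using dom Domain_mono by (auto simp: ext_def)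
    then show "In_diff (nam \<alpha>) (nam \<beta>) i q \<longleftrightarrow> i \<in> val p \<alpha> - val p \<beta>"
      unfolding In_diff_def Conj_def
      using Mem_nam_iff Neg_Mem_nam_iff val_mono[OF q] dom by simp
  qed (use p in \<open>simp add: Field_ext\<close>)
  also have "\<dots> \<longleftrightarrow> finite (T \<alpha> - T \<beta>)"
  proof -
    have fin: "finite (p `` {\<alpha>} \<union> p `` {\<beta>})"
      using condsD(1)[OF p] by (simp add: finite_Image)
    have "val p \<alpha> - val p \<beta> \<subseteq> (T \<alpha> - T \<beta>) \<union> (p `` {\<alpha>} \<union> p `` {\<beta>})"
      "T \<alpha> - T \<beta> \<subseteq> (val p \<alpha> - val p \<beta>) \<union> (p `` {\<alpha>} \<union> p `` {\<beta>})"
      by (auto simp: val_def)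
    then show ?thesis
      using fin by (meson finite_UnI finite_subset)
  qed
  also have "\<dots> \<longleftrightarrow> (\<alpha>, \<beta>) \<in> \<kappa>"
    using finite_diff_iff condsD(2)[OF p] dom by blast
  finally show ?thesis .
qed

lemma forced_Tower: "forced (Tower \<kappa> nam)"
proof -
  have "(Finite (In_diff (nam \<alpha>) (nam \<beta>)) \<^bold>\<longleftrightarrow> Ground ((\<alpha>, \<beta>) \<in> \<kappa>)) p"
    if p: "p \<in> conds" and \<alpha>\<beta>: "\<alpha> \<in> Field \<kappa>" "\<beta> \<in> Field \<kappa>" for p \<alpha> \<beta>
  proof -
    have dense: "\<exists>r. (r, q) \<in> ext \<and> (Finite (In_diff (nam \<alpha>) (nam \<beta>)) r \<longleftrightarrow> (\<alpha>, \<beta>) \<in> \<kappa>)"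
      if q: "(q, p) \<in> ext" for q
    proof -
      obtain r where r: "(r, q) \<in> ext" "\<alpha> \<in> Domain r" "\<beta> \<in> Domain r"
        by (rule ext_dense2[OF ext_conds[OF q] \<alpha>\<beta>])
      show ?thesis
        using r(1) Finite_nam_diff_iff[OF ext_conds[OF r(1)] r(2,3)] by (intro exI conjI)
    qed
    have "(\<alpha>, \<beta>) \<in> \<kappa>"
      if q: "(q, p) \<in> ext" and fin: "Finite (In_diff (nam \<alpha>) (nam \<beta>)) q" for q
    proof -
      obtain r where r: "(r, q) \<in> ext" "Finite (In_diff (nam \<alpha>) (nam \<beta>)) r \<longleftrightarrow> (\<alpha>, \<beta>) \<in> \<kappa>"
        using dense[OF q] by (elim exE conjE)
      show ?thesis
        using Finite_mono[OF fin r(1)] r(2) by (rule rev_iffD1)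
    qed
    moreover have "\<exists>r. (r, q) \<in> ext \<and> Finite (In_diff (nam \<alpha>) (nam \<beta>)) r"
      if "(q, p) \<in> ext" "(\<alpha>, \<beta>) \<in> \<kappa>" for q
      using dense[OF that(1)] that(2) by simp
    ultimately show ?thesis
      unfolding Iff_def Conj_def Imp_iff Ground_def using refl_R FieldI1 by metis
  qed
  then show ?thesis
    by (simp add: forced_def Tower_def Forall_def Field_ext)
qed

lemma forced_Close: "forced (Close \<kappa> T nam)"
proof -
  have "At_most_one (In_diff (check (T \<alpha>)) (nam \<alpha>)) p \<and>
      At_most_one (In_diff (nam \<alpha>) (check (T \<alpha>))) p"
    if p: "p \<in> conds" and \<alpha>: "\<alpha> \<in> Field \<kappa>" for p \<alpha>
  proof -
    have dense: "\<exists>r. (r, q) \<in> ext \<and> r \<in> conds \<and> \<alpha> \<in> Domain r \<and>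
        (\<exists>u v. T \<alpha> - val r \<alpha> = {u} \<and> val r \<alpha> - T \<alpha> = {v})" if q: "(q, p) \<in> ext" for q
    proof -
      obtain r where r: "(r, q) \<in> ext" "\<alpha> \<in> Domain r"
        by (rule conds_dense[OF ext_conds[OF q] \<alpha>])
      then have "r \<in> conds"
        using ext_conds by blast
      then obtain u v where "u \<in> T \<alpha>" "v \<notin> T \<alpha>" "r `` {\<alpha>} = {u, v}"
        using condsD(3) r(2) unfolding swap_def by blast
      then have "T \<alpha> - val r \<alpha> = {u} \<and> val r \<alpha> - T \<alpha> = {v}"
        by (auto simp: val_def)
      then show ?thesis
        using r \<open>r \<in> conds\<close> by blast
    qed
    have diff1: "i \<in> T \<alpha> - val r \<alpha>"
      if "In_diff (check (T \<alpha>)) (nam \<alpha>) i q" "(r, q) \<in> ext" "r \<in> conds" "\<alpha> \<in> Domain r" for i q r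
    proof -
      have q: "(i \<^bold>\<in> check (T \<alpha>)) q" "(\<^bold>\<not> i \<^bold>\<in> nam \<alpha>) q"
        using that(1) by (simp_all add: In_diff_def Conj_def)
      have "(i \<^bold>\<in> check (T \<alpha>)) r" "(\<^bold>\<not> i \<^bold>\<in> nam \<alpha>) r"
        by (fact Mem_mono[OF q(1) that(2)], fact Neg_mono[OF q(2) that(2)])
      then show ?thesis
        using that(3,4) by (simp add: Mem_check_iff Neg_Mem_nam_iff Field_ext)
    qed
    have diff2: "i \<in> val r \<alpha> - T \<alpha>"
      if "In_diff (nam \<alpha>) (check (T \<alpha>)) i q" "(r, q) \<in> ext" "r \<in> conds" "\<alpha> \<in> Domain r" for i q r
    proof -
      have q: "(i \<^bold>\<in> nam \<alpha>) q" "(\<^bold>\<not> i \<^bold>\<in> check (T \<alpha>)) q"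
        using that(1) by (simp_all add: In_diff_def Conj_def)
      have "(i \<^bold>\<in> nam \<alpha>) r" "(\<^bold>\<not> i \<^bold>\<in> check (T \<alpha>)) r"
        by (fact Mem_mono[OF q(1) that(2)], fact Neg_mono[OF q(2) that(2)])
      moreover have "\<not> (i \<^bold>\<in> check (T \<alpha>)) r"
        using NegD[OF calculation(2)] that(3) by (simp add: Field_ext)
      ultimately show ?thesis
        using that(3,4) by (simp add: Mem_check_iff Mem_nam_iff Field_ext)
    qed
    have "\<exists>r. (r, q) \<in> ext \<and> i = j"
      if q: "(q, p) \<in> ext" and diff:
        "In_diff (check (T \<alpha>)) (nam \<alpha>) i q \<and> In_diff (check (T \<alpha>)) (nam \<alpha>) j q \<or>
         In_diff (nam \<alpha>) (check (T \<alpha>)) i q \<and> In_diff (nam \<alpha>) (check (T \<alpha>)) j q" for q i j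
    proof -
      obtain r u v where r: "(r, q) \<in> ext" "r \<in> conds" "\<alpha> \<in> Domain r"
        and uv: "T \<alpha> - val r \<alpha> = {u}" "val r \<alpha> - T \<alpha> = {v}"
        using dense[OF q] by blast
      have "i \<in> {u} \<and> j \<in> {u} \<or> i \<in> {v} \<and> j \<in> {v}"
        using diff
      proof (elim disjE conjE)
        assume "In_diff (check (T \<alpha>)) (nam \<alpha>) i q" "In_diff (check (T \<alpha>)) (nam \<alpha>) j q"
        then show ?thesis
          using diff1[OF _ r] unfolding uv by blast
      next
        assume "In_diff (nam \<alpha>) (check (T \<alpha>)) i q" "In_diff (nam \<alpha>) (check (T \<alpha>)) j q"
        then show ?thesis
          using diff2[OF _ r] unfolding uv by blast
      qed
      then show ?thesis
        using r(1) by blast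
    qed
    then show ?thesis
      unfolding At_most_one_def Forall_def Imp_iff Conj_def Ground_def by blast
  qed
  then show ?thesis
    by (simp add: forced_def Close_def Forall_def Field_ext Conj_def)
qed

lemma not_forces_Subset:
  assumes p: "p \<in> conds" and dom: "\<alpha> \<in> Domain p" "\<beta> \<in> Domain p" "\<alpha> \<noteq> \<beta>"
  shows "\<not> Subset (nam \<alpha>) (nam \<beta>) p"
proof
  assume sub: "Subset (nam \<alpha>) (nam \<beta>) p"
  obtain n where n: "n \<in> val p \<alpha>" "n \<notin> val p \<beta>"
    using condsD(4)[OF p dom] by blast
  have imp: "(n \<^bold>\<in> nam \<alpha> \<^bold>\<longrightarrow> n \<^bold>\<in> nam \<beta>) p"
    using sub by (simp add: Subset_def Forall_def)
  have "(p, p) \<in> ext" "(n \<^bold>\<in> nam \<alpha>) p"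
    using p n Mem_nam_iff dom by (auto simp: ext_def)
  then obtain q where q: "(q, p) \<in> ext" "(n \<^bold>\<in> nam \<beta>) q"
    using ImpD[OF imp] by blast
  then have "n \<in> val q \<beta>"
    using Mem_nam_iff Domain_mono dom(2) by (metis Field_ext FieldI1)
  then show False
    using val_mono[OF q(1) dom(2)] n(2) by simp
qed

lemma forced_Cond_K: "forced (Cond_K \<kappa> nam)"
proof -
  have "(Ground (\<alpha> \<noteq> \<beta>) \<^bold>\<longrightarrow> (\<^bold>\<not> Subset (nam \<alpha>) (nam \<beta>))) p"
    if "p \<in> conds" and \<alpha>\<beta>: "\<alpha> \<in> Field \<kappa>" "\<beta> \<in> Field \<kappa>" for p \<alpha> \<beta>
    unfolding Imp_iff Ground_def
  proof (intro allI impI)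
    fix q
    assume q: "(q, p) \<in> ext \<and> \<alpha> \<noteq> \<beta>"
    then have "q \<in> conds"
      using ext_conds by blast
    then obtain r where r: "(r, q) \<in> ext" "\<alpha> \<in> Domain r" "\<beta> \<in> Domain r"
      using ext_dense2[OF _ \<alpha>\<beta>] by blast
    have "\<not> Subset (nam \<alpha>) (nam \<beta>) s" if "(s, r) \<in> ext" for s
      using not_forces_Subset[OF ext_conds[OF that]] Domain_mono[OF that] r(2,3) q by blast
    then show "\<exists>r. (r, q) \<in> ext \<and> (\<^bold>\<not> Subset (nam \<alpha>) (nam \<beta>)) r"
      unfolding Neg_def using r(1) by blast
  qed
  then show ?thesis
    by (simp add: forced_def Cond_K_def Forall_def Field_ext)
qed

end

theorem theorem21:
  fixes \<kappa> :: "'k rel" and T :: "'k \<Rightarrow> nat set"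
  assumes "Card_order \<kappa>" and "regularCard \<kappa>" and "natLeq <o \<kappa>"
    and "tower \<kappa> T" and "\<forall>\<alpha>\<in>Field \<kappa>. infinite (T \<alpha>)"
  shows "\<exists>(R :: ('k \<times> nat) set rel) (T' :: 'k \<Rightarrow> (nat, ('k \<times> nat) set) nm).
    forcing R \<and> forcing.ccc R
    \<and> (\<forall>\<alpha>\<in>Field \<kappa>. T' \<alpha> \<in> forcing.names R UNIV)
    \<and> forcing.forced R (forcing.Tower R \<kappa> T')
    \<and> forcing.forced R (forcing.Close R \<kappa> T T')
    \<and> forcing.forced R (forcing.Cond_K R \<kappa> T')"
proof -
  have "natLeq \<le>o \<kappa>"
    using assms(3) by (simp add: ordLess_imp_ordLeq)
  then have "infinite (Field \<kappa>)"
    using assms(1) by (metis cinfinite_def Field_natLeq natLeq_cinfinite cinfinite_mono)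
  then interpret infinite_tower \<kappa> T
    using assms by unfold_locales auto
  show ?thesis
    using forcing_axioms ccc_ext nam_names forced_Tower forced_Close forced_Cond_K by blast
qed

end
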